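(* There exists a constant $C>0$, independent of $n$ and $d$, such that for all integers $d\geq 3$ and $n\geq 2$ one has $\gamma(\Omega_{n,d})\leq 2^{-Cnd}$.
   Context: For $i\in[n]$ let $\varepsilon_i:=e_i-\frac1n\mathbb{1}_n\in\mathbb{R}^n$, where $e_i$ is the $i$-th standard unit vector and $\mathbb{1}_n$ the all-ones vector. Let $\Omega_{n,d}:=\{\varepsilon_i: i\in[n]\}^d=\{(\varepsilon_{i_1},\dots,\varepsilon_{i_d}):i_1,\dots,i_d\in[n]\}\subseteq(\mathbb{R}^n)^d$. For a finite set $\Omega\subseteq\mathbb{R}^m$, its margin is $\gamma(\Omega):=\min\{\operatorname{dist}(0,\operatorname{conv}(S)) : S\subseteq\Omega,\ 0\notin\operatorname{conv}(S)\}$ (Euclidean distance). *)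

theory Defs
  imports "HOL-Analysis.Analysis" "HOL-Analysis.Finite_Function_Topology"
begin

text \<open>
  The dimension has to vary inside a single formula, so a vector of $\mathbb{R}^m$ is represented as
  a finitely supported real function on the index type, being zero outside the relevant indices.
  Linear structure and convex hulls are those of the library. The \<^const>\<open>norm\<close> and \<^const>\<open>dist\<close>
  which the library puts on \<^typ>\<open>'a \<Rightarrow>\<^sub>0 real\<close> are of $\ell^1$ type, hence the Euclidean versions below.
\<close>

definition euclid_dist :: "('a \<Rightarrow>\<^sub>0 real) \<Rightarrow> ('a \<Rightarrow>\<^sub>0 real) \<Rightarrow> real" where
  "euclid_dist x y = L2_set (Poly_Mapping.lookup (x - y)) (Poly_Mapping.keys (x - y))"

definition euclid_infdist :: "('a \<Rightarrow>\<^sub>0 real) \<Rightarrow> ('a \<Rightarrow>\<^sub>0 real) set \<Rightarrow> real" where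
  "euclid_infdist x A = (INF a\<in>A. euclid_dist x a)"

text \<open>
  The empty set is excluded explicitly: its distance to the origin is $\infty$ by convention, whereas
  the real-valued infimum over the empty set would contribute an arbitrary number.
\<close>

definition margin :: "('a \<Rightarrow>\<^sub>0 real) set \<Rightarrow> real" where
  "margin \<Omega> = Min {euclid_infdist 0 (convex hull S) | S. S \<subseteq> \<Omega> \<and> S \<noteq> {} \<and> 0 \<notin> convex hull S}"

definition eps :: "nat \<Rightarrow> nat \<Rightarrow> (nat \<Rightarrow>\<^sub>0 real)" where
  "eps n i = Poly_Mapping.single i 1 - (1 / real n) *\<^sub>R (\<Sum>j=1..n. Poly_Mapping.single j 1)"

text \<open>
  \<open>tuple n d v\<close> is $(v_1, \ldots, v_d) \in (\mathbb{R}^n)^d$; its coordinate \<open>(k, j)\<close> is the \<open>j\<close>-th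
  coordinate of \<open>v k\<close>.
\<close>

definition tuple :: "nat \<Rightarrow> nat \<Rightarrow> (nat \<Rightarrow> (nat \<Rightarrow>\<^sub>0 real)) \<Rightarrow> (nat \<times> nat \<Rightarrow>\<^sub>0 real)" where
  "tuple n d v = (\<Sum>k=1..d. \<Sum>j=1..n. Poly_Mapping.single (k, j) (Poly_Mapping.lookup (v k) j))"

definition Omega :: "nat \<Rightarrow> nat \<Rightarrow> (nat \<times> nat \<Rightarrow>\<^sub>0 real) set" where
  "Omega n d = {tuple n d (\<lambda>k. eps n (i k)) | i. \<forall>k\<in>{1..d}. i k \<in> {1..n}}"

lemma lookup_scaleR: "Poly_Mapping.lookup (c *\<^sub>R x) k = c *\<^sub>R Poly_Mapping.lookup x k"
  by (simp add: scaleR_poly_mapping_def Poly_Mapping.map.rep_eq when_def)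

lemma lookup_eps:
  assumes "i \<in> {1..n}"
  shows "Poly_Mapping.lookup (eps n i) j =
    (if j \<in> {1..n} then (if j = i then 1 else 0) - 1 / real n else 0)"
  using assms
  by (auto simp: eps_def lookup_minus lookup_scaleR lookup_sum lookup_single when_def)

lemma lookup_tuple:
  "Poly_Mapping.lookup (tuple n d v) (k, j) =
    (if k \<in> {1..d} \<and> j \<in> {1..n} then Poly_Mapping.lookup (v k) j else 0)"
proof -
  have "Poly_Mapping.lookup (tuple n d v) (k, j) =
      (\<Sum>k'=1..d. if k' = k then (\<Sum>j'=1..n. if j' = j then Poly_Mapping.lookup (v k) j else 0) else 0)"
    unfolding tuple_def lookup_sum
    by (intro sum.cong refl) (auto simp: lookup_single when_def intro!: sum.cong)
  also have "\<dots> = (if k \<in> {1..d} \<and> j \<in> {1..n} then Poly_Mapping.lookup (v k) j else 0)"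
    by (simp add: sum.delta)
  finally show ?thesis .
qed

lemma finite_Omega: "finite (Omega n d)"
proof -
  have "Omega n d \<subseteq> (\<lambda>i. tuple n d (\<lambda>k. eps n (i k))) ` ({1..d} \<rightarrow>\<^sub>E {1..n})"
  proof
    fix x assume "x \<in> Omega n d"
    then obtain i where i: "\<forall>k\<in>{1..d}. i k \<in> {1..n}" and x: "x = tuple n d (\<lambda>k. eps n (i k))"
      by (auto simp: Omega_def)
    have "x = tuple n d (\<lambda>k. eps n (restrict i {1..d} k))"
      unfolding x tuple_def by (intro sum.cong refl) simp
    moreover have "restrict i {1..d} \<in> {1..d} \<rightarrow>\<^sub>E {1..n}"
      using i by auto
    ultimately show "x \<in> (\<lambda>i. tuple n d (\<lambda>k. eps n (i k))) ` ({1..d} \<rightarrow>\<^sub>E {1..n})"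
      by blast
  qed
  then show ?thesis
    by (rule finite_subset) (intro finite_imageI finite_PiE, auto)
qed

lemma finite_margin_set:
  assumes "finite \<Omega>"
  shows "finite {euclid_infdist 0 (convex hull S) | S. S \<subseteq> \<Omega> \<and> S \<noteq> {} \<and> 0 \<notin> convex hull S}"
  by (rule finite_subset[where B = "(\<lambda>S. euclid_infdist 0 (convex hull S)) ` Pow \<Omega>"])
     (use assms in auto)

lemma margin_set_Omega_nonempty:
  assumes "n \<ge> 2" "d \<ge> 1"
  shows "{euclid_infdist 0 (convex hull S) | S. S \<subseteq> Omega n d \<and> S \<noteq> {} \<and> 0 \<notin> convex hull S} \<noteq> {}"
proof -
  define x where "x = tuple n d (\<lambda>k. eps n 1)"
  have "x \<in> Omega n d"
    unfolding Omega_def x_def using assms by force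
  moreover have "Poly_Mapping.lookup x (1, 1) \<noteq> 0"
    using assms by (simp add: x_def lookup_tuple lookup_eps)
  then have "0 \<notin> convex hull {x}"
    by auto
  ultimately show ?thesis
    by blast
qed

end

theory Submission
  imports Defs "HOL-Probability.Probability_Mass_Function"
begin

text \<open>
  Put $n = m + 1$ and $r = \lfloor d/3 \rfloor$, and cut the first $3r$ legs into $r$ groups of three.
  In a group only the blocks $D_j = (j,j,j)$, $A_j = (j,n,j+1)$, $B_j = (n,j,j+1)$, for $j \le m$ in the last two
  cases, and $E = (n,n,1)$ are used. A probability measure on words all of whose marginals are uniform must satisfy
  $P(A_j) = P(B_j) = 2^{j-1} P(E)$ in each group, because value $j$ is equally likely on the three legs
  and the blocks $D_j$ do not matter. We only admit words where group $g + 1$ is $E$ exactly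
  when group $g$ is $A_m$ or $B_m$; then $P(E)$ grows by the factor $2^m$ from each group to the next. If
  moreover $D_n$ is forbidden in the last group, then $P(E) = 2^{-mr}/n$ in the first group.

  Forbidding $E$ in the first group hence leaves a set of words without any uniform measure, which is witnessed by
  a linear functional with constant negative value on it. Replacing $E$ by $D_1$ in the
  first group of the uniform measure moves four coordinates by $2^{-mr}/n$ each, so the convex hull
  contains a point at distance $2 \cdot 2^{-mr}/n \le 2^{-mr}$ from the origin. The uniform measure itself is a
  Markov chain of blocks, glued from couplings of consecutive groups.
\<close>

section \<open>Gluing couplings of consecutive laws into a Markov chain\<close>

lemma map_pmf_bool_eqI:
  assumes "measure_pmf.prob p {x. P x} = measure_pmf.prob q {y. Q y}"
  shows "map_pmf P p = map_pmf Q q"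
proof (rule pmf_eqI)
  have True: "pmf (map_pmf P p) True = pmf (map_pmf Q q) True"
    using assms by (simp add: pmf_map vimage_def)
  fix b show "pmf (map_pmf P p) b = pmf (map_pmf Q q) b"
    using True by (cases b) (simp_all add: pmf_False_conv_True)
qed

text \<open>By induction on the length: given the first coordinates, the next one is sampled from
  the coupling of \<open>q g\<close> and \<open>q (Suc g)\<close> conditioned on the value of
  coordinate \<open>g\<close>. Each step only has to respect the current last coordinate, so
  pairwise couplings suffice.\<close>

lemma rel_pmf_chain_coupling:
  fixes q :: "nat \<Rightarrow> 'a pmf"
  assumes "\<And>h. h < g \<Longrightarrow> rel_pmf R (q h) (q (Suc h))"
    and "\<And>h. h \<le> g \<Longrightarrow> finite (set_pmf (q h))"
  shows "\<exists>p. finite (set_pmf p) \<and> (\<forall>h\<le>g. map_pmf (\<lambda>f. f h) p = q h) \<and>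
    (\<forall>f\<in>set_pmf p. \<forall>h<g. R (f h) (f (Suc h)))"
  using assms
proof (induction g)
  case 0
  show ?case
    by (rule exI[of _ "map_pmf (\<lambda>b _. b) (q 0)"]) (use 0 in \<open>auto simp: pmf.map_comp o_def\<close>)
next
  case (Suc g)
  then obtain p where fin: "finite (set_pmf p)"
    and marg: "\<And>h. h \<le> g \<Longrightarrow> map_pmf (\<lambda>f. f h) p = q h"
    and R: "\<And>f h. f \<in> set_pmf p \<Longrightarrow> h < g \<Longrightarrow> R (f h) (f (Suc h))"
    using Suc.IH by force
  obtain pq where pq: "\<And>x y. (x, y) \<in> set_pmf pq \<Longrightarrow> R x y"
    "map_pmf fst pq = q g" "map_pmf snd pq = q (Suc g)"
    using Suc.prems(1)[of g] by (auto elim!: rel_pmf.cases)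
  \<comment> \<open>\<open>K\<close> is the transition kernel: the law of the second component of
    \<open>pq\<close> given that the first is \<open>x\<close>. Overwriting only coordinate
    \<open>Suc g\<close> keeps the earlier marginals.\<close>
  define K where "K x = map_pmf snd (cond_pmf pq {z. x = fst z})" for x
  define p' where "p' = bind_pmf p (\<lambda>f. map_pmf (\<lambda>b. f(Suc g := b)) (K (f g)))"
  have fg: "f g \<in> set_pmf (q g)" if "f \<in> set_pmf p" for f
    using that marg[of g] by (metis order_refl imageI pmf.set_map)
  have ne: "set_pmf pq \<inter> {z. x = fst z} \<noteq> {}" if "x \<in> set_pmf (q g)" for x
    using that unfolding pq(2)[symmetric] by auto
  have setK: "set_pmf (K x) = {b. (x, b) \<in> set_pmf pq}" if "x \<in> set_pmf (q g)" for x
    using ne[OF that] by (auto simp: K_def set_cond_pmf image_iff Bex_def)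
  \<comment> \<open>Disintegration: averaging the conditional laws over the first marginal gives
    back \<open>pq\<close>, so the kernel carries \<open>q g\<close> to
    \<open>q (Suc g)\<close>.\<close>
  have "bind_pmf (q g) (\<lambda>x. cond_pmf pq {z. x = fst z}) = pq"
  proof (rule bind_cond_pmf_cancel)
    show "measure_pmf.prob pq {z. x = fst z} = measure_pmf.prob (q g) {x. x = fst y}"
      if "x \<in> set_pmf (q g)" "y \<in> set_pmf pq" "x = fst y" for x y
    proof -
      have "{z. x = fst z} = fst -` {x. x = fst y}"
        using that by auto
      then show ?thesis by (metis measure_map_pmf pq(2))
    qed
  qed (use ne in \<open>auto simp flip: pq(2)\<close>)
  then have "q (Suc g) = bind_pmf (q g) K"
    unfolding pq(3)[symmetric] K_def by (metis map_bind_pmf)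
  also have "\<dots> = bind_pmf p (\<lambda>f. K (f g))"
    by (simp add: marg[of g, symmetric] bind_map_pmf)
  finally have last: "map_pmf (\<lambda>f. f (Suc g)) p' = q (Suc g)"
    by (simp add: p'_def map_bind_pmf pmf.map_comp o_def)
  have prev: "map_pmf (\<lambda>f. f h) p' = q h" if "h \<le> g" for h
    using that by (simp add: p'_def map_bind_pmf pmf.map_comp o_def marg flip: map_pmf_def)
  have finK: "finite (set_pmf (K (f g)))" if "f \<in> set_pmf p" for f
  proof (rule finite_subset)
    show "set_pmf (K (f g)) \<subseteq> set_pmf (q (Suc g))"
      unfolding setK[OF fg[OF that]] pq(3)[symmetric] by force
  qed (use Suc.prems(2) in simp)
  have "\<forall>f\<in>set_pmf p'. \<forall>h<Suc g. R (f h) (f (Suc h))"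
    using R fg pq(1) by (auto simp: p'_def setK less_Suc_eq)
  moreover have "finite (set_pmf p')"
    using fin finK by (auto simp: p'_def)
  ultimately show ?case
    using last prev by (intro exI[of _ p']) (auto simp: le_Suc_eq)
qed

section \<open>Blocks of three legs and a law on them with uniform marginals\<close>

datatype block = D nat | A nat | B nat | E

fun coord :: "nat \<Rightarrow> nat \<Rightarrow> block \<Rightarrow> nat" where
  "coord m p (D j) = j"
| "coord m p (A j) = (if p = 0 then j else if p = 1 then Suc m else Suc j)"
| "coord m p (B j) = (if p = 0 then Suc m else if p = 1 then j else Suc j)"
| "coord m p E = (if p = 2 then 1 else Suc m)"

definition top_block :: "nat \<Rightarrow> block \<Rightarrow> bool" where
  "top_block m b \<longleftrightarrow> b = A m \<or> b = B m"

definition blocks :: "nat \<Rightarrow> block set" where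
  "blocks m = D ` {1..Suc m} \<union> A ` {1..m} \<union> B ` {1..m} \<union> {E}"

lemma finite_blocks [simp]: "finite (blocks m)"
  by (simp add: blocks_def)

lemma sum_blocks:
  fixes F :: "block \<Rightarrow> real"
  shows "sum F (blocks m) = (\<Sum>j=1..Suc m. F (D j)) + (\<Sum>j=1..m. F (A j)) + (\<Sum>j=1..m. F (B j)) + F E"
proof -
  have "sum F (blocks m) = sum F (D ` {1..Suc m}) + sum F (A ` {1..m}) + sum F (B ` {1..m}) + sum F {E}"
    unfolding blocks_def by (subst sum.union_disjoint; (subst sum.union_disjoint)?; auto)+
  then show ?thesis
    by (simp add: sum.reindex inj_on_def)
qed

lemma coord_in_range:
  assumes "b \<in> blocks m"
  shows "coord m p b \<in> {1..Suc m}"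
  using assms by (auto simp: blocks_def)

text \<open>
  Here \<open>\<eta>\<close> is half the probability of \<open>E\<close>, which avoids the exponent \<open>j - 1\<close>.
\<close>

fun weight :: "nat \<Rightarrow> real \<Rightarrow> block \<Rightarrow> real" where
  "weight m \<eta> (D j) = (if j \<in> {1..Suc m} then 1 / real (Suc m) - 2 ^ j * \<eta> else 0)"
| "weight m \<eta> (A j) = (if j \<in> {1..m} then 2 ^ j * \<eta> else 0)"
| "weight m \<eta> (B j) = (if j \<in> {1..m} then 2 ^ j * \<eta> else 0)"
| "weight m \<eta> E = 2 * \<eta>"

lemma sum_pow2: "(\<Sum>j=1..m. 2 ^ j * \<eta>) = (2 ^ Suc m - 2) * (\<eta>::real)"
  by (induction m) (auto simp: algebra_simps)

text \<open>\<open>D j\<close> takes up what the other blocks leave of 1/n, where n =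
  \<open>Suc m\<close>. On the first two legs a value j < n also comes from \<open>A j\<close> or
  \<open>B j\<close>, with mass \<open>2 ^ j * \<eta>\<close>, and n collects the geometric sum of
  the other family plus \<open>E\<close>. On the third leg j > 1 comes from \<open>A (j - 1)\<close>
  and \<open>B (j - 1)\<close>, half that mass each, and 1 comes from \<open>E\<close>.\<close>

lemma sum_weight_coord:
  assumes "p < 3" "j \<in> {1..Suc m}"
  shows "(\<Sum>b\<in>blocks m. weight m \<eta> b * of_bool (coord m p b = j)) = 1 / real (Suc m)"
proof -
  have D: "(\<Sum>i=1..Suc m. weight m \<eta> (D i) * of_bool (i = j)) = 1 / real (Suc m) - 2 ^ j * \<eta>"
  proof -
    have "(\<Sum>i=1..Suc m. weight m \<eta> (D i) * of_bool (i = j))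
      = (\<Sum>i=1..Suc m. if i = j then weight m \<eta> (D j) else 0)"
      by (intro sum.cong) auto
    then show ?thesis using assms(2) by (simp del: sum.cl_ivl_Suc)
  qed
  \<comment> \<open>With \<open>X\<close> being \<open>A\<close> or \<open>B\<close>, the three sums
    cover the legs on which block \<open>X i\<close> has the value i, the constant n, and i +
    1.\<close>
  have eq: "(\<Sum>i=1..m. weight m \<eta> (X i) * of_bool (i = j)) = (if j \<le> m then 2 ^ j * \<eta> else 0)"
    and top: "(\<Sum>i=1..m. weight m \<eta> (X i) * of_bool (Suc m = j))
      = (if j = Suc m then (2 ^ Suc m - 2) * \<eta> else 0)"
    and suc: "(\<Sum>i=1..m. weight m \<eta> (X i) * of_bool (Suc i = j)) = (if j = 1 then 0 else 2 ^ j * \<eta> / 2)"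
    if "\<And>i. i \<in> {1..m} \<Longrightarrow> weight m \<eta> (X i) = 2 ^ i * \<eta>" for X
  proof -
    have "(\<Sum>i=1..m. weight m \<eta> (X i) * of_bool (i = j)) = (\<Sum>i=1..m. if i = j then 2 ^ j * \<eta> else 0)"
      using that by (intro sum.cong) auto
    then show "(\<Sum>i=1..m. weight m \<eta> (X i) * of_bool (i = j)) = (if j \<le> m then 2 ^ j * \<eta> else 0)"
      using assms(2) by auto
    have "(\<Sum>i=1..m. weight m \<eta> (X i) * of_bool (Suc m = j)) = (\<Sum>i=1..m. 2 ^ i * \<eta>) * of_bool (Suc m = j)"
      unfolding sum_distrib_right using that by (intro sum.cong) auto
    then show "(\<Sum>i=1..m. weight m \<eta> (X i) * of_bool (Suc m = j))
      = (if j = Suc m then (2 ^ Suc m - 2) * \<eta> else 0)"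
      unfolding sum_pow2 by auto
    have "(\<Sum>i=1..m. weight m \<eta> (X i) * of_bool (Suc i = j))
      = (\<Sum>i=1..m. if i = j - 1 then 2 ^ (j - 1) * \<eta> else 0)"
      using that assms(2) by (intro sum.cong) auto
    then show "(\<Sum>i=1..m. weight m \<eta> (X i) * of_bool (Suc i = j)) = (if j = 1 then 0 else 2 ^ j * \<eta> / 2)"
      using assms(2) by (cases j) auto
  qed
  have A: "weight m \<eta> (A i) = 2 ^ i * \<eta>" and B: "weight m \<eta> (B i) = 2 ^ i * \<eta>" if "i \<in> {1..m}" for i
    using that by simp_all
  note AB = eq[of A, OF A] top[of A, OF A] suc[of A, OF A] eq[of B, OF B] top[of B, OF B] suc[of B, OF B]
  consider "p = 0" | "p = 1" | "p = 2" using assms(1) by linarith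
  then show ?thesis
    unfolding sum_blocks coord.simps D
    by cases (use assms(2) in \<open>simp_all only: AB if_True if_False zero_neq_one one_neq_zero refl
        numeral_eq_one_iff one_eq_numeral_iff zero_neq_numeral numeral_neq_zero num.distinct\<close>,
      auto simp: algebra_simps)
qed

lemma sum_weight: "(\<Sum>b\<in>blocks m. weight m \<eta> b) = 1"
proof -
  have "(\<Sum>b\<in>blocks m. weight m \<eta> b)
    = (\<Sum>j=1..Suc m. 1 / real (Suc m) - 2 ^ j * \<eta>) + (\<Sum>j=1..m. 2 ^ j * \<eta>) + (\<Sum>j=1..m. 2 ^ j * \<eta>) + 2 * \<eta>"
    unfolding sum_blocks by (intro arg_cong2[where f = "(+)"] sum.cong) auto
  also have "\<dots> = 1"
    unfolding sum_subtractf sum_pow2 by (simp add: algebra_simps)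
  finally show ?thesis .
qed

definition block_pmf :: "nat \<Rightarrow> real \<Rightarrow> block pmf" where
  "block_pmf m \<eta> = embed_pmf (weight m \<eta>)"

text \<open>The upper bound on \<open>\<eta>\<close> says that \<open>D (Suc m)\<close>, the
  lightest of the \<open>D\<close> blocks, has nonnegative weight.\<close>

lemma pmf_block_pmf:
  assumes "0 \<le> \<eta>" "2 ^ Suc m * \<eta> \<le> 1 / real (Suc m)"
  shows "pmf (block_pmf m \<eta>) b = weight m \<eta> b"
  unfolding block_pmf_def
proof (rule pmf_embed_pmf)
  show nonneg: "0 \<le> weight m \<eta> b" for b
  proof -
    have "2 ^ j * \<eta> \<le> 1 / real (Suc m)" if "j \<le> Suc m" for j
      using mult_right_mono[OF power_increasing[OF that, of "2::real"] assms(1)] assms(2) by simp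
    then show ?thesis
      using assms(1) by (cases b) auto
  qed
  have "(\<integral>\<^sup>+ b. ennreal (weight m \<eta> b) \<partial>count_space UNIV) = (\<Sum>b\<in>blocks m. ennreal (weight m \<eta> b))"
  proof (rule nn_integral_count_space')
    show "ennreal (weight m \<eta> b) = 0" if "b \<notin> blocks m" for b
      using that by (cases b) (auto simp: blocks_def)
  qed auto
  also have "\<dots> = 1"
    by (simp add: sum_ennreal nonneg sum_weight)
  finally show "(\<integral>\<^sup>+ b. ennreal (weight m \<eta> b) \<partial>count_space UNIV) = 1" .
qed

lemma set_block_pmf:
  assumes "0 \<le> \<eta>" "2 ^ Suc m * \<eta> \<le> 1 / real (Suc m)"
  shows "set_pmf (block_pmf m \<eta>) \<subseteq> blocks m"
proof
  fix b assume "b \<in> set_pmf (block_pmf m \<eta>)"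
  then have "weight m \<eta> b \<noteq> 0"
    using pmf_block_pmf[OF assms] by (simp add: set_pmf_iff)
  then show "b \<in> blocks m"
    by (cases b) (auto simp: blocks_def split: if_splits)
qed

text \<open>The two top blocks weigh \<open>2 ^ m * \<eta>\<close> each. Compared with
  \<open>2 * \<eta>\<close> for \<open>E\<close>, this is the growth factor \<open>2 ^ m\<close>
  between consecutive groups.\<close>

lemma prob_top_block:
  assumes "0 \<le> \<eta>" "2 ^ Suc m * \<eta> \<le> 1 / real (Suc m)" "1 \<le> m"
  shows "measure_pmf.prob (block_pmf m \<eta>) {b. top_block m b} = 2 ^ Suc m * \<eta>"
proof -
  have "{b. top_block m b} = {A m, B m}"
    by (auto simp: top_block_def)
  then show ?thesis
    using assms by (simp add: measure_measure_pmf_finite pmf_block_pmf)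
qed

lemma prob_E:
  assumes "0 \<le> \<eta>" "2 ^ Suc m * \<eta> \<le> 1 / real (Suc m)"
  shows "measure_pmf.prob (block_pmf m \<eta>) {b. b = E} = 2 * \<eta>"
  using assms by (simp add: measure_pmf_single pmf_block_pmf)

section \<open>From block laws to words and their vectors\<close>

lemma sum_pmf_comp:
  fixes g :: "'b \<Rightarrow> real"
  assumes "finite X" "set_pmf p \<subseteq> X" "finite Y" "set_pmf (map_pmf F p) \<subseteq> Y"
  shows "(\<Sum>f\<in>X. pmf p f * g (F f)) = (\<Sum>b\<in>Y. pmf (map_pmf F p) b * g b)"
proof -
  have "(\<Sum>f\<in>X. pmf p f * g (F f)) = measure_pmf.expectation p (\<lambda>f. g (F f))"
    using assms(1,2) by (subst integral_measure_pmf_real[where A = X]) (auto simp: mult.commute)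
  also have "\<dots> = measure_pmf.expectation (map_pmf F p) g"
    by simp
  also have "\<dots> = (\<Sum>b\<in>Y. pmf (map_pmf F p) b * g b)"
    using assms(3,4) by (subst integral_measure_pmf_real[where A = Y]) (auto simp: mult.commute)
  finally show ?thesis .
qed

text \<open>\<open>D 1\<close> agrees with \<open>E\<close> on the third leg, so the replacement
  disturbs only the first two legs, where it turns n into 1.\<close>

definition remove_E :: "block \<Rightarrow> block" where
  "remove_E b = (if b = E then D 1 else b)"

lemma sum_remove_E:
  fixes w g :: "block \<Rightarrow> real"
  shows "(\<Sum>b\<in>blocks m. w b * g (remove_E b)) = (\<Sum>b\<in>blocks m. w b * g b) + w E * (g (D 1) - g E)"
  by (simp add: sum_blocks remove_E_def algebra_simps)

text \<open>
  The legs left over after the last group copy the third leg of the first group, whose marginal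
  is not affected by \<^const>\<open>remove_E\<close>.
\<close>

definition word :: "nat \<Rightarrow> nat \<Rightarrow> (nat \<Rightarrow> block) \<Rightarrow> nat \<Rightarrow> nat" where
  "word m r f k = (if k \<le> 3 * r then coord m ((k - 1) mod 3) (f ((k - 1) div 3)) else coord m 2 (f 0))"

definition word_vec :: "nat \<Rightarrow> nat \<Rightarrow> nat \<Rightarrow> (nat \<Rightarrow> block) \<Rightarrow> (nat \<times> nat \<Rightarrow>\<^sub>0 real)" where
  "word_vec m d r f = tuple (Suc m) d (\<lambda>k. eps (Suc m) (word m r f k))"

lemma word_in_range:
  assumes "\<And>h. h < r \<Longrightarrow> f h \<in> blocks m" "0 < r" "1 \<le> k"
  shows "word m r f k \<in> {1..Suc m}"
proof -
  have "k \<le> 3 * r \<Longrightarrow> (k - 1) div 3 < r"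
    using assms(3) by linarith
  then show ?thesis
    unfolding word_def using assms coord_in_range by simp
qed

lemma lookup_word_vec:
  assumes "\<And>h. h < r \<Longrightarrow> f h \<in> blocks m" "0 < r"
  shows "Poly_Mapping.lookup (word_vec m d r f) (k, j) =
    (if k \<in> {1..d} \<and> j \<in> {1..Suc m} then of_bool (word m r f k = j) - 1 / real (Suc m) else 0)"
  unfolding word_vec_def lookup_tuple
  using word_in_range[of r f m k] assms by (auto simp: lookup_eps)

lemma word_vec_in_Omega:
  assumes "\<And>h. h < r \<Longrightarrow> f h \<in> blocks m" "0 < r"
  shows "word_vec m d r f \<in> Omega (Suc m) d"
  unfolding word_vec_def Omega_def using word_in_range[of r f m] assms by force

section \<open>The separating functional\<close>

definition block_functional :: "nat \<Rightarrow> (nat \<Rightarrow> nat \<Rightarrow> real) \<Rightarrow> real" where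
  "block_functional m x = (\<Sum>j=1..m. (1/2) ^ j * (2 * x 2 j - x 0 j - x 1 j))"

text \<open>The coefficients 2, -1, -1 cancel the constant \<open>c\<close> and every
  \<open>D j\<close>. For \<open>A j\<close> and \<open>B j\<close> with j < m, doubling the third
  leg offsets the halved weight at j + 1; for j = m the third leg is n, which has no weight, and
  \<open>- (1/2) ^ m\<close> remains. \<open>E\<close> gives 2 * (1/2) = 1.\<close>

lemma block_functional_coord:
  assumes "b \<in> blocks m" "1 \<le> m"
  shows "block_functional m (\<lambda>p j. of_bool (coord m p b = j) - c) =
    of_bool (b = E) - (1/2) ^ m * of_bool (top_block m b)"
proof -
  have pick: "(\<Sum>j=1..m. (1/2) ^ j * of_bool (v = j)) = (if v \<in> {1..m} then (1/2) ^ v else (0::real))" for v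
  proof -
    have "(\<Sum>j=1..m. (1/2) ^ j * of_bool (v = j)) = (\<Sum>j=1..m. if j = v then (1/2) ^ v else (0::real))"
      by (intro sum.cong) auto
    then show ?thesis by simp
  qed
  have "block_functional m (\<lambda>p j. of_bool (coord m p b = j) - c) =
      2 * (\<Sum>j=1..m. (1/2) ^ j * of_bool (coord m 2 b = j))
      - (\<Sum>j=1..m. (1/2) ^ j * of_bool (coord m 0 b = j)) - (\<Sum>j=1..m. (1/2) ^ j * of_bool (coord m 1 b = j))"
    unfolding block_functional_def sum_distrib_left sum_subtractf[symmetric]
    by (intro sum.cong refl) (simp add: algebra_simps)
  then show ?thesis
    unfolding pick using assms by (auto simp: blocks_def top_block_def)
qed

text \<open>
  On admissible words the group terms telescope to minus the indicator of a top block in the last group, which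
  agrees with the indicator of value $n$ on leg $3r$.
\<close>

definition separator :: "nat \<Rightarrow> nat \<Rightarrow> (nat \<times> nat \<Rightarrow>\<^sub>0 real) \<Rightarrow> real" where
  "separator m r x =
    (\<Sum>g<r. (1/2) ^ (m * g) * block_functional m (\<lambda>p j. Poly_Mapping.lookup x (Suc (3 * g + p), j)))
    + (1/2) ^ (m * r) * Poly_Mapping.lookup x (3 * r, Suc m)"

lemma separator_linear:
  "separator m r (u *\<^sub>R x + v *\<^sub>R y) = u * separator m r x + v * separator m r y"
  by (simp add: separator_def block_functional_def lookup_add lookup_scaleR sum_distrib_left
      sum.distrib algebra_simps sum_subtractf)

lemma convex_separator_level: "convex {x. separator m r x = c}"
  by (auto simp: convex_def separator_linear simp flip: distrib_right)

lemma separator_word_vec: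
  assumes blocks: "\<And>h. h < r \<Longrightarrow> f h \<in> blocks m" and "0 < r" "1 \<le> m" "3 * r \<le> d"
    and first: "f 0 \<noteq> E" and last: "f (r - 1) \<noteq> D (Suc m)"
    and link: "\<And>h. Suc h < r \<Longrightarrow> f (Suc h) = E \<longleftrightarrow> top_block m (f h)"
  shows "separator m r (word_vec m d r f) = - ((1/2) ^ (m * r) / real (Suc m))"
proof -
  have lookup: "Poly_Mapping.lookup (word_vec m d r f) (Suc (3 * g + p), j)
      = of_bool (coord m p (f g) = j) - 1 / real (Suc m)"
    if "g < r" "p < 3" "j \<in> {1..Suc m}" for g p j
  proof -
    have "(3 * g + p) div 3 = g" "(3 * g + p) mod 3 = p" "Suc (3 * g + p) \<le> 3 * r"
      using that by auto
    then have "word m r f (Suc (3 * g + p)) = coord m p (f g)"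
      by (simp add: word_def)
    then show ?thesis
      using that assms by (subst lookup_word_vec) auto
  qed
  have group: "block_functional m (\<lambda>p j. Poly_Mapping.lookup (word_vec m d r f) (Suc (3 * g + p), j))
      = of_bool (f g = E) - (1/2) ^ m * of_bool (top_block m (f g))" if "g < r" for g
  proof -
    have "block_functional m (\<lambda>p j. Poly_Mapping.lookup (word_vec m d r f) (Suc (3 * g + p), j))
      = block_functional m (\<lambda>p j. of_bool (coord m p (f g) = j) - 1 / real (Suc m))"
      unfolding block_functional_def
      by (intro sum.cong refl) (subst (1 2 3) lookup; use that in simp)
    then show ?thesis
      using block_functional_coord[OF blocks[OF that] assms(3)] by simp
  qed
  \<comment> \<open>By \<open>link\<close>, the negative top term of one group cancels the
    \<open>E\<close> term of the next, whose scale is smaller by exactly \<open>(1/2) ^ m\<close>;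
    \<open>first\<close> removes the initial \<open>E\<close> term.\<close>
  have telescope: "(\<Sum>g<Suc s. (1/2) ^ (m * g) * (of_bool (f g = E) - (1/2) ^ m * of_bool (top_block m (f g)) :: real))
      = - ((1/2) ^ (m * Suc s) * of_bool (top_block m (f s)))" if "s < r" for s :: nat
    using that
  proof (induction s)
    case 0
    then show ?case using first by simp
  next
    case (Suc s)
    then show ?case using link[of s] by (simp add: algebra_simps power_add)
  qed
  obtain s where s: "r = Suc s"
    using assms(2) by (cases r) auto
  \<comment> \<open>Besides the top blocks only \<open>D (Suc m)\<close> has value n on the third
    leg, and \<open>last\<close> excludes it.\<close>
  have "coord m 2 (f s) = Suc m \<longleftrightarrow> top_block m (f s)"
    using blocks[of s] last s \<open>1 \<le> m\<close> by (auto simp: blocks_def top_block_def)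
  then have "Poly_Mapping.lookup (word_vec m d r f) (3 * r, Suc m)
      = of_bool (top_block m (f s)) - 1 / real (Suc m)"
    using lookup[of s 2 "Suc m"] s by (simp add: numeral_3_eq_3 numeral_2_eq_2)
  moreover have "(\<Sum>g<r. (1/2) ^ (m * g) *
      block_functional m (\<lambda>p j. Poly_Mapping.lookup (word_vec m d r f) (Suc (3 * g + p), j)))
      = - ((1/2) ^ (m * r) * of_bool (top_block m (f s)))"
    using telescope[of s] s group by simp
  ultimately show ?thesis
    unfolding separator_def by (simp only: right_diff_distrib) simp
qed

section \<open>The upper bound on the margin\<close>

lemma margin_le:
  assumes "finite \<Omega>" "S \<subseteq> \<Omega>" "x \<in> convex hull S" "0 \<notin> convex hull S"
  shows "margin \<Omega> \<le> euclid_dist 0 x"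
proof -
  have "margin \<Omega> \<le> euclid_infdist 0 (convex hull S)"
    unfolding margin_def using assms finite_margin_set[OF assms(1)] by (intro Min_le) auto
  also have "\<dots> \<le> euclid_dist 0 x"
    unfolding euclid_infdist_def
    by (intro cINF_lower assms bdd_belowI2[where m = 0]) (simp add: euclid_dist_def)
  finally show ?thesis .
qed

lemma euclid_dist_0_le:
  assumes "finite K" "\<And>i. i \<notin> K \<Longrightarrow> Poly_Mapping.lookup x i = 0"
    and "\<And>i. i \<in> K \<Longrightarrow> \<bar>Poly_Mapping.lookup x i\<bar> \<le> c" "0 \<le> c"
  shows "euclid_dist 0 x \<le> sqrt (real (card K)) * c"
proof -
  have "(\<Sum>i\<in>Poly_Mapping.keys (0 - x). (Poly_Mapping.lookup (0 - x) i)\<^sup>2) \<le> (\<Sum>i\<in>K. c\<^sup>2)"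
  proof (rule sum_le_included[where i = id])
    show "\<forall>i\<in>Poly_Mapping.keys (0 - x). \<exists>j\<in>K. id j = i \<and> (Poly_Mapping.lookup (0 - x) i)\<^sup>2 \<le> c\<^sup>2"
    proof
      fix i assume "i \<in> Poly_Mapping.keys (0 - x)"
      then have "i \<in> K" using assms(2) by (auto simp: in_keys_iff)
      then show "\<exists>j\<in>K. id j = i \<and> (Poly_Mapping.lookup (0 - x) i)\<^sup>2 \<le> c\<^sup>2"
        using assms(3)[of i] assms(4) by (auto simp flip: abs_le_square_iff)
    qed
  qed (use assms in auto)
  then have "euclid_dist 0 x \<le> sqrt (real (card K) * c\<^sup>2)"
    unfolding euclid_dist_def L2_set_def by (intro real_sqrt_le_mono) simp
  then show ?thesis
    using assms(4) by (simp add: real_sqrt_mult)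
qed

lemma margin_Omega_le:
  assumes "1 \<le> m" "0 < r" "3 * r \<le> d"
  shows "margin (Omega (Suc m) d) \<le> (1/2) ^ (m * r)"
proof -
  \<comment> \<open>Solves \<open>\<eta> (Suc h) = 2 ^ m * \<eta> h\<close> for h < r backwards from
    \<open>\<eta> r\<close> = 1/(2n), the value that makes \<open>D (Suc m)\<close> weightless in
    group r - 1.\<close>
  define \<eta> :: "nat \<Rightarrow> real" where "\<eta> h = 1 / (real (Suc m) * (2 * 2 ^ (m * (r - h))))" for h
  have \<eta>_nonneg: "0 \<le> \<eta> h" for h
    by (simp add: \<eta>_def)
  have \<eta>_Suc: "2 ^ Suc m * \<eta> h = 2 * \<eta> (Suc h)" if "h < r" for h
  proof -
    have "r - h = Suc (r - Suc h)" using that by simp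
    then show ?thesis by (simp add: \<eta>_def power_add field_simps del: of_nat_Suc)
  qed
  have \<eta>_le: "2 ^ Suc m * \<eta> h \<le> 1 / real (Suc m)" if "h < r" for h
    unfolding \<eta>_Suc[OF that] by (simp add: \<eta>_def field_simps del: of_nat_Suc)
  have \<eta>_last: "2 ^ Suc m * \<eta> (r - 1) = 1 / real (Suc m)"
    using \<eta>_Suc[of "r - 1"] assms(2) by (simp add: \<eta>_def del: power_Suc of_nat_Suc)
  define \<beta> where "\<beta> h = block_pmf m (\<eta> h)" for h
  define q where "q h = (if h = 0 then map_pmf remove_E (\<beta> 0) else \<beta> h)" for h :: nat
  have pmf_\<beta>: "pmf (\<beta> h) = weight m (\<eta> h)" if "h < r" for h
    unfolding \<beta>_def using pmf_block_pmf[OF \<eta>_nonneg \<eta>_le[OF that]] by (rule ext)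
  have set_\<beta>: "set_pmf (\<beta> h) \<subseteq> blocks m" if "h < r" for h
    unfolding \<beta>_def using set_block_pmf[OF \<eta>_nonneg \<eta>_le[OF that]] .
  have set_q: "set_pmf (q h) \<subseteq> blocks m" if "h < r" for h
    using set_\<beta>[OF that] by (auto simp: q_def remove_E_def blocks_def)
  \<comment> \<open>The events "top block now" and "\<open>E\<close> next" have equal probability,
    so their indicators have the same law and can be coupled to be equal. \<open>remove_E\<close>
    neither creates nor destroys a top block.\<close>
  have "rel_pmf (\<lambda>x y. top_block m x = (y = E)) (q h) (q (Suc h))" if "h < r - 1" for h
  proof -
    from that have that: "Suc h < r" by simp
    have "map_pmf (top_block m) (\<beta> h) = map_pmf (\<lambda>b. b = E) (\<beta> (Suc h))"
      unfolding \<beta>_def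
      by (rule map_pmf_bool_eqI) (simp only: prob_top_block[OF \<eta>_nonneg \<eta>_le[OF Suc_lessD[OF that]] assms(1)]
        prob_E[OF \<eta>_nonneg \<eta>_le[OF that]] \<eta>_Suc[OF Suc_lessD[OF that]])
    moreover have "map_pmf (top_block m) (q h) = map_pmf (top_block m) (\<beta> h)"
      by (auto simp: q_def pmf.map_comp remove_E_def top_block_def intro!: map_pmf_cong split: if_splits)
    ultimately have "rel_pmf (=) (map_pmf (top_block m) (q h)) (map_pmf (\<lambda>b. b = E) (q (Suc h)))"
      by (simp add: pmf.rel_eq q_def)
    then show ?thesis
      by (simp add: pmf.rel_map)
  qed
  moreover have "finite (set_pmf (q h))" if "h \<le> r - 1" for h
    using finite_subset[OF set_q finite_blocks] that assms(2) by simp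
  ultimately have "\<exists>p. finite (set_pmf p) \<and> (\<forall>h\<le>r - 1. map_pmf (\<lambda>f. f h) p = q h) \<and>
      (\<forall>f\<in>set_pmf p. \<forall>h<r - 1. top_block m (f h) = (f (Suc h) = E))"
    by (rule rel_pmf_chain_coupling)
  then obtain p where fin: "finite (set_pmf p)"
    and marg: "\<And>h. h < r \<Longrightarrow> map_pmf (\<lambda>f. f h) p = q h"
    and link: "\<And>f h. f \<in> set_pmf p \<Longrightarrow> Suc h < r \<Longrightarrow> top_block m (f h) = (f (Suc h) = E)"
    using assms(2) by (fastforce simp: less_eq_Suc_le)
  have in_q: "f h \<in> set_pmf (q h)" if "f \<in> set_pmf p" "h < r" for f h
    using that marg[of h] by (metis imageI pmf.set_map)
  have in_blocks: "f h \<in> blocks m" if "f \<in> set_pmf p" "h < r" for f h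
    using in_q[OF that] set_q[OF that(2)] by blast
  \<comment> \<open>The mean of the word vectors under \<open>p\<close>: its coordinates are the leg
    marginals minus 1/n.\<close>
  define x where "x = (\<Sum>f\<in>set_pmf p. pmf p f *\<^sub>R word_vec m d r f)"
  define S where "S = word_vec m d r ` set_pmf p"
  have "S \<subseteq> Omega (Suc m) d"
    using word_vec_in_Omega in_blocks assms(2) by (auto simp: S_def)
  moreover have "x \<in> convex hull S"
    unfolding x_def by (rule convex_sum) (auto simp: fin S_def sum_pmf_eq_1 intro: hull_inc)
  moreover have "0 \<notin> convex hull S"
  proof -
    \<comment> \<open>A level set of the linear \<open>separator\<close> at a nonzero value is
      convex and misses the origin.\<close>
    let ?H = "{x. separator m r x = - ((1/2) ^ (m * r) / real (Suc m))}"
    have "S \<subseteq> ?H"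
    proof
      fix y assume "y \<in> S"
      then obtain f where f: "f \<in> set_pmf p" "y = word_vec m d r f"
        by (auto simp: S_def)
      have "f 0 \<noteq> E"
        using in_q[OF f(1) assms(2)] by (auto simp: q_def remove_E_def split: if_splits)
      moreover have "D (Suc m) \<notin> set_pmf (\<beta> (r - 1))"
        using \<eta>_last assms(2) by (simp add: set_pmf_iff pmf_\<beta> del: power_Suc)
      \<comment> \<open>If r = 1, the last group is also the modified one, but
        \<open>remove_E\<close> only introduces \<open>D 1\<close>, which differs from
        \<open>D (Suc m)\<close> as m >= 1.\<close>
      then have "f (r - 1) \<noteq> D (Suc m)"
        using in_q[OF f(1), of "r - 1"] assms(1,2)
        by (auto simp: q_def remove_E_def split: if_splits)
      ultimately show "y \<in> ?H"
        unfolding f(2) using separator_word_vec[of r f m d] in_blocks[OF f(1)] link[OF f(1)] assms by simp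
    qed
    moreover have "convex ?H"
      by (rule convex_separator_level)
    ultimately have "convex hull S \<subseteq> ?H"
      by (rule hull_minimal)
    moreover have "separator m r 0 = 0"
      using separator_linear[of m r 0 0 0 0] by simp
    ultimately show ?thesis by auto
  qed
  ultimately have "margin (Omega (Suc m) d) \<le> euclid_dist 0 x"
    using margin_le finite_Omega by blast
  also have "\<dots> \<le> sqrt (real (card ({1, 2 :: nat} \<times> {1, Suc m}))) * (2 * \<eta> 0)"
  proof (rule euclid_dist_0_le)
    have lookup: "Poly_Mapping.lookup x (k, j) =
        (if k \<in> {1..d} \<and> j \<in> {1..Suc m}
         then (\<Sum>f\<in>set_pmf p. pmf p f * of_bool (word m r f k = j)) - 1 / real (Suc m) else 0)" for k j
    proof -
      have "Poly_Mapping.lookup x (k, j) = (\<Sum>f\<in>set_pmf p. pmf p f *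
        (if k \<in> {1..d} \<and> j \<in> {1..Suc m} then of_bool (word m r f k = j) - 1 / real (Suc m) else 0))"
        unfolding x_def lookup_sum lookup_scaleR
        by (intro sum.cong refl) (subst lookup_word_vec; use in_blocks assms(2) in simp)
      then show ?thesis
        using sum_pmf_eq_1[OF fin order_refl]
        by (auto simp: right_diff_distrib sum_subtractf simp flip: sum_divide_distrib)
    qed
    \<comment> \<open>All marginals of \<open>\<beta> h\<close> are uniform, so the only deviation
      is the mass \<open>2 * \<eta> 0\<close> that \<open>remove_E\<close> moves from
      \<open>E\<close> to \<open>D 1\<close> in group 0.\<close>
    have coord: "(\<Sum>f\<in>set_pmf p. pmf p f * of_bool (coord m i (f h) = j)) - 1 / real (Suc m) =
        (if h = 0 then 2 * \<eta> 0 * (of_bool (1 = j) - of_bool (coord m i E = j)) else 0)"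
      if "h < r" "i < 3" "j \<in> {1..Suc m}" for h i j
    proof -
      have exact: "(\<Sum>b\<in>blocks m. pmf (\<beta> h) b * of_bool (coord m i b = j)) = 1 / real (Suc m)"
        unfolding pmf_\<beta>[OF that(1)] by (rule sum_weight_coord[OF that(2,3)])
      show ?thesis
      proof (cases "h = 0")
        case True
        have "map_pmf (\<lambda>f. f 0) p = map_pmf remove_E (\<beta> 0)"
          using marg[OF that(1)] True by (simp add: q_def)
        then have "(\<Sum>f\<in>set_pmf p. pmf p f * of_bool (coord m i (f 0) = j))
          = (\<Sum>b\<in>blocks m. pmf (map_pmf remove_E (\<beta> 0)) b * of_bool (coord m i b = j))"
          using sum_pmf_comp[OF fin order_refl finite_blocks, of "\<lambda>f. f 0" m "\<lambda>b. of_bool (coord m i b = j)"]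
            set_q[OF assms(2)] by (simp add: q_def)
        also have "\<dots> = (\<Sum>b\<in>blocks m. pmf (\<beta> 0) b * of_bool (coord m i (remove_E b) = j))"
          using sum_pmf_comp[OF finite_blocks set_\<beta>[OF assms(2)] finite_blocks, of remove_E m "\<lambda>b. of_bool (coord m i b = j)"]
            set_q[OF assms(2)] by (simp add: q_def)
        also have "\<dots> = (\<Sum>b\<in>blocks m. pmf (\<beta> 0) b * of_bool (coord m i b = j))
            + pmf (\<beta> 0) E * (of_bool (coord m i (D 1) = j) - of_bool (coord m i E = j))"
          by (rule sum_remove_E)
        also have "\<dots> = 1 / real (Suc m) + 2 * \<eta> 0 * (of_bool (1 = j) - of_bool (coord m i E = j))"
          using exact unfolding True by (simp only: pmf_\<beta>[OF assms(2)] weight.simps(4) coord.simps(1))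
        finally show ?thesis using True by simp
      next
        case False
        then show ?thesis
          using sum_pmf_comp[OF fin order_refl finite_blocks, of "\<lambda>f. f h" m "\<lambda>b. of_bool (coord m i b = j)"]
            exact set_q[OF that(1)] marg[OF that(1)] by (simp add: q_def)
      qed
    qed
    \<comment> \<open>On the third leg of group 0, and on the surplus legs copying it,
      \<open>E\<close> and \<open>D 1\<close> have the same value and the deviation cancels.\<close>
    have entry: "Poly_Mapping.lookup x (k, j) =
        (if k \<in> {1, 2} \<and> j \<in> {1..Suc m} then 2 * \<eta> 0 * (of_bool (1 = j) - of_bool (Suc m = j)) else 0)" for k j
    proof (cases "k \<in> {1..d} \<and> j \<in> {1..Suc m}")
      case False
      moreover have "2 \<le> d" using assms(2,3) by linarith
      ultimately show ?thesis by (auto simp: lookup)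
    next
      case kj: True
      show ?thesis
      proof (cases "k \<le> 3 * r")
        case True
        define h i where "h = (k - 1) div 3" and "i = (k - 1) mod 3"
        have hi: "h < r" "i < 3" "k = Suc (3 * h + i)"
          using True kj by (auto simp: h_def i_def)
        have "Poly_Mapping.lookup x (k, j) =
            (if h = 0 then 2 * \<eta> 0 * (of_bool (1 = j) - of_bool (coord m i E = j)) else 0)"
          using coord[OF hi(1,2)] kj True by (simp add: lookup word_def h_def i_def)
        then show ?thesis
          using hi kj by auto
      next
        case False
        have "k \<noteq> 1" "k \<noteq> 2"
          using False assms(2) by auto
        then show ?thesis
          using coord[OF assms(2), of 2 j] kj False by (simp add: lookup word_def)
      qed
    qed
    show "Poly_Mapping.lookup x i = 0" if "i \<notin> {1, 2} \<times> {1, Suc m}" for i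
      using that by (cases i) (auto simp: entry)
    show "\<bar>Poly_Mapping.lookup x i\<bar> \<le> 2 * \<eta> 0" if "i \<in> {1, 2} \<times> {1, Suc m}" for i
      using that \<eta>_nonneg[of 0] by (auto simp: entry)
  qed (use \<eta>_nonneg in auto)
  also have "\<dots> = 2 * (2 * \<eta> 0)"
    using assms(1) by (simp add: card_cartesian_product)
  also have "\<dots> \<le> (1/2) ^ (m * r)"
  proof -
    have "2 * (2 * \<eta> 0) = 2 / real (Suc m) * (1/2) ^ (m * r)"
      by (simp add: \<eta>_def power_one_over del: of_nat_Suc)
    also have "\<dots> \<le> 1 * (1/2) ^ (m * r)"
      using assms(1) by (intro mult_right_mono) auto
    finally show ?thesis by simp
  qed
  finally show ?thesis .
qed

theorem theorem1p3:
  shows "\<exists>C::real. C > 0 \<and>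
    (\<forall>d n :: nat. d \<ge> 3 \<longrightarrow> n \<ge> 2 \<longrightarrow>
      margin (Omega n d) \<le> 2 powr (- (C * real n * real d)))"
proof (intro exI[of _ "1/10 :: real"] conjI allI impI)
  fix d n :: nat
  assume d: "d \<ge> 3" and n: "n \<ge> 2"
  define m r where "m = n - 1" and "r = d div 3"
  \<comment> \<open>The constant 1/10 comes from d <= 5r, tight at d = 5, and n <= 2m, tight at n =
    2; together they give nd <= 10mr.\<close>
  have "d \<le> 5 * r"
    unfolding r_def using d by presburger
  moreover have "n = Suc m" "1 \<le> m" "0 < r" "3 * r \<le> d" "n \<le> 2 * m"
    using d n by (auto simp: m_def r_def)
  ultimately have "margin (Omega n d) \<le> (1/2) ^ (m * r)"
    using margin_Omega_le by simp
  also have "\<dots> = 2 powr (- real (m * r))"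
    by (simp only: powr_minus powr_realpow zero_less_numeral power_one_over inverse_eq_divide)
  also have "\<dots> \<le> 2 powr (- (1/10 * real n * real d))"
  proof -
    have "n * d \<le> (2 * m) * (5 * r)"
      by (intro mult_mono) (use \<open>n \<le> 2 * m\<close> \<open>d \<le> 5 * r\<close> in auto)
    then have "real (n * d) \<le> real (10 * (m * r))"
      by (simp only: of_nat_le_iff)
    then show ?thesis
      by (intro powr_mono) auto
  qed
  finally show "margin (Omega n d) \<le> 2 powr (- (1/10 * real n * real d))" .
qed simp

end
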